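(* Let $K$ be an algebraically closed field. Let $\beta_1=(-1,0,1)$, $\beta_2=(-\tfrac23,\tfrac13,\tfrac13)$, $\beta_3=(-\tfrac13,-\tfrac13,\tfrac23)$, $\beta_4=(-\tfrac12,0,\tfrac12)$, $\beta_5=(0,0,0)$, and let $S_{\beta_1},\dots,S_{\beta_5}$ be the corresponding Hesselink strata of $\mathcal{N}_{3,2}$. Then \begin{align*} S_{\beta_5}&=\{O\},\\ S_{\beta_4}&=\mathrm{GL}_3(K)\cdot\{E_\lambda,E_\infty\mid\lambda\in K\},\\ S_{\beta_3}&=\mathrm{GL}_3(K)\cdot\{D\},\\ S_{\beta_2}&=\mathrm{GL}_3(K)\cdot\{C\},\\ S_{\beta_1}&=\mathrm{GL}_3(K)\cdot\{A_{\lambda,\mu},A_{\lambda,\infty},A_{\infty,\lambda},B_{\lambda,\mu'},B_{\infty,\lambda}\mid\lambda,\mu,\mu'\in K,\ \mu\ne0\}. \end{align*}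
   Context: $E_{ij}$ denotes the $3\times 3$ matrix unit with entry $1$ in position $(i,j)$ and $0$ elsewhere. $\mathrm{GL}_3(K)$ acts on $(K^{3\times 3})^2$ by simultaneous conjugation, $g\cdot(A_1,A_2)=(gA_1g^{-1},gA_2g^{-1})$. $\mathcal{N}_{3,2}$ is the set of pairs $(A_1,A_2)\in (K^{3\times 3})^2$ such that $A_1,A_2$ generate a nilpotent (non-unital) subalgebra of $K^{3\times 3}$. Named pairs: $A_{\lambda,\mu}=(E_{21}+E_{32},\lambda(E_{21}+E_{32})+\mu E_{32})$ ($\lambda,\mu\in K$, $\mu\ne0$); $A_{\lambda,\infty}=(E_{21},\lambda E_{21}+E_{32})$ ($\lambda\in K$); $A_{\infty,\lambda}=(E_{32},E_{21}+\lambda E_{32})$ ($\lambda\in K$); $B_{\lambda,\mu}=(E_{21}+E_{32},\lambda(E_{21}+E_{32})+\mu E_{31})$ ($\lambda,\mu\in K$); $B_{\infty,\lambda}=(\lambda E_{31},E_{21}+E_{32})$ ($\lambda\in K$); $C=(E_{21},E_{31})$; $D=(E_{31},E_{32})$; $E_\lambda=(E_{21},\lambda E_{21})$ ($\lambda\in K$); $E_\infty=(0,E_{21})$; $O=(0,0)$. Hesselink strata of $\mathcal{N}_{3,2}$ (defined by optimal destabilizing rational one-parameter subgroups): for $b=(b_1,b_2,b_3)\in\mathbb{Q}^3$ and $A=(A_1,A_2)\in (K^{3\times3})^2$ say that $b$ is admissible for $A$ if $b_i-b_j\ge 1$ for every position $(i,j)$ at which $A_1$ or $A_2$ has a non-zero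 entry. For $A\in\mathcal{N}_{3,2}$ consider all pairs $(g,b)\in\mathrm{GL}_3(K)\times\mathbb{Q}^3$ such that $b$ is admissible for $g\cdot A$. Among these pairs the minimum of $b_1^2+b_2^2+b_3^2$ is attained, and for the minimizing pairs the increasing rearrangement of $b$ depends only on $A$ (Kempf, Hesselink). For an increasing sequence $\beta\in\mathbb{Q}^3$, the stratum $S_\beta$ is the set of those $A\in\mathcal{N}_{3,2}$ for which this increasing rearrangement equals $\beta$. The five sequences $\beta_1,\dots,\beta_5$ are the ones for which the stratum is non-empty. *)

theory Defs
  imports "HOL-Analysis.Analysis" "HOL-Computational_Algebra.Polynomial"
begin

text \<open>
  Matrices over a field \<open>'k\<close> have type \<open>'k^3^3\<close>, with \<open>A $ i $ j\<close> the entry in row \<open>i\<close> and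
  column \<open>j\<close>. In the index type \<open>3\<close> the numeral \<open>3\<close> denotes the same element as \<open>0\<close>.
\<close>

type_synonym 'k mat3 = "'k^3^3"

definition mat_unit :: "3 \<Rightarrow> 3 \<Rightarrow> 'k::field mat3" where
  "mat_unit i j = axis i (axis j 1)"

definition mat_smult :: "'k::field \<Rightarrow> 'k mat3 \<Rightarrow> 'k mat3" (infixr \<open>*m\<close> 75) where
  "c *m A = map_matrix ((*) c) A"


definition conj_act :: "'k::field mat3 \<Rightarrow> 'k mat3 \<times> 'k mat3 \<Rightarrow> 'k mat3 \<times> 'k mat3" where
  "conj_act g A = (g ** fst A ** matrix_inv g, g ** snd A ** matrix_inv g)"

definition GL_orbits :: "('k::field mat3 \<times> 'k mat3) set \<Rightarrow> ('k mat3 \<times> 'k mat3) set" where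
  "GL_orbits X = {conj_act g A | g A. invertible g \<and> A \<in> X}"


definition nonunital_subalgebra :: "'k::field mat3 set \<Rightarrow> bool" where
  "nonunital_subalgebra S \<longleftrightarrow>
     0 \<in> S \<and> (\<forall>A\<in>S. \<forall>B\<in>S. A + B \<in> S) \<and> (\<forall>c. \<forall>A\<in>S. c *m A \<in> S) \<and>
     (\<forall>A\<in>S. \<forall>B\<in>S. A ** B \<in> S)"

definition nilpotent_algebra :: "'k::field mat3 set \<Rightarrow> bool" where
  "nilpotent_algebra S \<longleftrightarrow>
     (\<exists>n\<ge>1. \<forall>Ms. length Ms = n \<and> set Ms \<subseteq> S \<longrightarrow> foldr (**) Ms (mat 1) = 0)"

definition nilpotent_pairs :: "('k::field mat3 \<times> 'k mat3) set" where
  "nilpotent_pairs = {A. nilpotent_algebra (nonunital_subalgebra hull {fst A, snd A})}"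


definition admissible :: "rat^3 \<Rightarrow> 'k::field mat3 \<times> 'k mat3 \<Rightarrow> bool" where
  "admissible b A \<longleftrightarrow>
     (\<forall>i j. fst A $ i $ j \<noteq> 0 \<or> snd A $ i $ j \<noteq> 0 \<longrightarrow> b $ i - b $ j \<ge> 1)"

definition minimizing_pair :: "'k::field mat3 \<times> 'k mat3 \<Rightarrow> 'k mat3 \<times> (rat^3) \<Rightarrow> bool" where
  "minimizing_pair A =
     is_arg_min (\<lambda>(g, b). (b $ 1)^2 + (b $ 2)^2 + (b $ 3)^2)
                (\<lambda>(g, b). invertible g \<and> admissible b (conj_act g A))"

definition increasing_rearrangement :: "rat^3 \<Rightarrow> rat list" where
  "increasing_rearrangement b = sort [b $ 1, b $ 2, b $ 3]"

text \<open>
  Attainment of the minimum and independence of the rearranged sequence from the minimizing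
  pair (Kempf, Hesselink) are not presupposed: membership in a stratum requires that a minimizing
  pair exists and that all of them have the prescribed rearrangement.
\<close>

definition hesselink_stratum :: "rat list \<Rightarrow> ('k::field mat3 \<times> 'k mat3) set" where
  "hesselink_stratum \<beta> = {A \<in> nilpotent_pairs.
     (\<exists>g b. minimizing_pair A (g, b)) \<and>
     (\<forall>g b. minimizing_pair A (g, b) \<longrightarrow> increasing_rearrangement b = \<beta>)}"


definition pair_A :: "'k::field \<Rightarrow> 'k \<Rightarrow> 'k mat3 \<times> 'k mat3" where
  "pair_A l m = (mat_unit 2 1 + mat_unit 3 2,
                 l *m (mat_unit 2 1 + mat_unit 3 2) + m *m mat_unit 3 2)"

text \<open>The suffix \<open>fin_inf\<close> stands for the index pair \<open>\<lambda>, \<infinity>\<close> and \<open>inf_fin\<close> for \<open>\<infinity>, \<lambda>\<close>.\<close>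

definition pair_A_fin_inf :: "'k::field \<Rightarrow> 'k mat3 \<times> 'k mat3" where
  "pair_A_fin_inf l = (mat_unit 2 1, l *m mat_unit 2 1 + mat_unit 3 2)"

definition pair_A_inf_fin :: "'k::field \<Rightarrow> 'k mat3 \<times> 'k mat3" where
  "pair_A_inf_fin l = (mat_unit 3 2, mat_unit 2 1 + l *m mat_unit 3 2)"

definition pair_B :: "'k::field \<Rightarrow> 'k \<Rightarrow> 'k mat3 \<times> 'k mat3" where
  "pair_B l m = (mat_unit 2 1 + mat_unit 3 2,
                 l *m (mat_unit 2 1 + mat_unit 3 2) + m *m mat_unit 3 1)"

definition pair_B_inf_fin :: "'k::field \<Rightarrow> 'k mat3 \<times> 'k mat3" where
  "pair_B_inf_fin l = (l *m mat_unit 3 1, mat_unit 2 1 + mat_unit 3 2)"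

definition pair_C :: "'k::field mat3 \<times> 'k mat3" where
  "pair_C = (mat_unit 2 1, mat_unit 3 1)"

definition pair_D :: "'k::field mat3 \<times> 'k mat3" where
  "pair_D = (mat_unit 3 1, mat_unit 3 2)"

definition pair_E :: "'k::field \<Rightarrow> 'k mat3 \<times> 'k mat3" where
  "pair_E l = (mat_unit 2 1, l *m mat_unit 2 1)"

definition pair_E_inf :: "'k::field mat3 \<times> 'k mat3" where
  "pair_E_inf = (0, mat_unit 2 1)"

definition pair_O :: "'k::field mat3 \<times> 'k mat3" where
  "pair_O = (0, 0)"

end

theory Submission
  imports Defs
begin

text \<open>
  The strata are pairwise disjoint, so it suffices to know two things: the five families of normal
  forms meet every orbit of nilpotent pairs (lemma \<open>nilpotent_pair_cases\<close>), and each
  family lies inside the stratum that the theorem assigns to it (the lemmas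
  \<open>GL_orbits_stratum_...\<close>). Equality then holds for every family at once.

  Classification. A nonzero product of maximal length in the algebra generated by the pair has a
  row and a column that give a complete flag stable under the pair, so the pair is conjugate to a
  strictly lower triangular one with entries \<open>a\<^sub>i\<close> at (2,1), \<open>b\<^sub>i\<close>
  at (3,2) and \<open>c\<^sub>i\<close> at (3,1). Think of \<open>a\<close>, \<open>b\<close>,
  \<open>c\<close> as vectors in the plane, indexed by \<open>i\<close>. If \<open>a\<close> and
  \<open>b\<close> are both nonzero, torus conjugation rescales them independently, and unipotent
  conjugation adds any combination of \<open>a\<close> and \<open>b\<close> to \<open>c\<close>; this
  produces the families \<open>A\<close> (\<open>a\<close>, \<open>b\<close> independent) and
  \<open>B\<close> (dependent). If \<open>a = 0\<close>, only the third row survives and the pair is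
  of type \<open>D\<close>, of type \<open>E\<close> or zero; if \<open>b = 0\<close>, only the first
  column survives and the pair is of type \<open>C\<close>, of type \<open>E\<close> or zero.

  Strata. An admissible weight for a conjugate is constrained only by the positions of the nonzero
  entries there, and each type forces a configuration of positions that survives every conjugation.
  For the types \<open>A\<close> and \<open>B\<close> some product of two members is nonzero, so some
  positions \<open>(i,j)\<close>, \<open>(j,k)\<close> occur. For type \<open>C\<close> the two
  matrices have a common row factor and independent column factors, so \<open>(i,j)\<close>,
  \<open>(k,j)\<close> with \<open>i \<noteq> k\<close> occur; type \<open>D\<close> is dual. For type
  \<open>E\<close> some position occurs. The lemmas \<open>chain_bound\<close>,
  \<open>fork_bound\<close>, \<open>cofork_bound\<close> and \<open>edge_bound\<close> minimize the
  norm under exactly these constraints. Every minimum is attained at one point only, up to the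
  choice of the indices, which gives the rearranged sequence, and the normal form itself attains it.
\<close>

section \<open>Three by three matrices and conjugation\<close>

abbreviation mat_rows :: "'k::field \<Rightarrow> 'k \<Rightarrow> 'k \<Rightarrow> 'k \<Rightarrow> 'k \<Rightarrow> 'k \<Rightarrow> 'k \<Rightarrow> 'k \<Rightarrow> 'k \<Rightarrow> 'k mat3" where
  "mat_rows a b c d e f g h i \<equiv> vector [vector [a, b, c], vector [d, e, f], vector [g, h, i]]"

abbreviation lower :: "'k::field \<Rightarrow> 'k \<Rightarrow> 'k \<Rightarrow> 'k mat3" where
  "lower a b c \<equiv> mat_rows 0 0 0 a 0 0 c b 0"

lemma mat_eq_iff: "(A::'k::field mat3) = B \<longleftrightarrow>
   A$1$1 = B$1$1 \<and> A$1$2 = B$1$2 \<and> A$1$3 = B$1$3 \<and>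
   A$2$1 = B$2$1 \<and> A$2$2 = B$2$2 \<and> A$2$3 = B$2$3 \<and>
   A$3$1 = B$3$1 \<and> A$3$2 = B$3$2 \<and> A$3$3 = B$3$3"
  by (auto simp: vec_eq_iff forall_3)

lemma mult_entry: "((A::'k::field mat3) ** B) $ i $ j = A$i$1 * B$1$j + A$i$2 * B$2$j + A$i$3 * B$3$j"
  by (simp add: matrix_matrix_mult_def sum_3)

lemma normal_forms_lower:
  "pair_A l m = (lower 1 1 0, lower l (l + m) 0)"
  "pair_A_fin_inf l = (lower 1 0 0, lower l 1 0)"
  "pair_A_inf_fin l = (lower 0 1 0, lower 1 l 0)"
  "pair_B l m = (lower 1 1 0, lower l l m)"
  "pair_B_inf_fin l = (lower 0 0 l, lower 1 1 0)"
  "pair_C = (lower 1 0 0, lower 0 0 1)"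
  "pair_D = (lower 0 0 1, lower 0 1 0)"
  "pair_E l = (lower 1 0 0, lower l 0 0)"
  "pair_E_inf = (lower 0 0 0, lower 1 0 0)"
  "pair_O = (lower 0 0 0, lower 0 0 0)"
  by (simp_all add: pair_A_def pair_A_fin_inf_def pair_A_inf_fin_def pair_B_def
      pair_B_inf_fin_def pair_C_def pair_D_def pair_E_def pair_E_inf_def pair_O_def
      mat_eq_iff mat_unit_def axis_def mat_smult_def map_matrix_def)

lemma matrix_inv_inverse:
  fixes g :: "'k::field mat3"
  assumes "invertible g"
  shows "g ** matrix_inv g = mat 1" "matrix_inv g ** g = mat 1"
proof -
  have "\<exists>h. g ** h = mat 1 \<and> h ** g = mat 1"
    using assms by (simp add: invertible_def)
  then have "g ** matrix_inv g = mat 1 \<and> matrix_inv g ** g = mat 1"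
    unfolding matrix_inv_def by (rule someI_ex)
  then show "g ** matrix_inv g = mat 1" "matrix_inv g ** g = mat 1" by auto
qed

lemma matrix_inv_unique:
  fixes g :: "'k::field mat3"
  assumes "g ** h = mat 1"
  shows "matrix_inv g = h"
proof -
  have "invertible g" using assms invertible_right_inverse by blast
  then show ?thesis
    by (metis assms matrix_inv_inverse(2) matrix_mul_assoc matrix_mul_lid matrix_mul_rid)
qed

lemma invertible_matrix_inv:
  fixes g :: "'k::field mat3"
  assumes "invertible g"
  shows "invertible (matrix_inv g)"
  using assms matrix_inv_inverse invertible_def by blast

lemma conj_act_comp:
  fixes g h :: "'k::field mat3"
  assumes "invertible g" "invertible h"
  shows "conj_act g (conj_act h A) = conj_act (g ** h) A"
proof -
  have "(g ** h) ** (matrix_inv h ** matrix_inv g) = mat 1"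
    using assms by (metis matrix_inv_inverse(1) matrix_mul_assoc matrix_mul_rid)
  then have "matrix_inv (g ** h) = matrix_inv h ** matrix_inv g" by (rule matrix_inv_unique)
  then show ?thesis by (simp add: conj_act_def matrix_mul_assoc)
qed

lemma conj_act_one: "conj_act (mat 1 :: 'k::field mat3) A = A"
proof -
  have "matrix_inv (mat 1 :: 'k mat3) = mat 1" by (rule matrix_inv_unique) simp
  then show ?thesis by (simp add: conj_act_def)
qed

lemma conj_act_inverse:
  fixes g :: "'k::field mat3"
  assumes "invertible g"
  shows "conj_act (matrix_inv g) (conj_act g A) = A"
  using assms by (simp add: conj_act_comp invertible_matrix_inv matrix_inv_inverse conj_act_one)

text \<open>
  Conjugacy is certified by intertwining relations, which avoid computing an inverse: they are
  entrywise polynomial identities once the conjugating matrix is written out.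
\<close>

lemma conj_act_eqI:
  fixes g :: "'k::field mat3"
  assumes "invertible g" "A1 ** g = g ** N1" "A2 ** g = g ** N2"
  shows "conj_act g (N1, N2) = (A1, A2)"
  using assms by (simp add: conj_act_def flip: assms(2,3) matrix_mul_assoc)
    (simp add: matrix_inv_inverse)

lemma GL_orbitsI:
  fixes g :: "'k::field mat3"
  assumes "invertible g" "A1 ** g = g ** N1" "A2 ** g = g ** N2" "(N1, N2) \<in> X"
  shows "(A1, A2) \<in> GL_orbits X"
  unfolding GL_orbits_def using assms conj_act_eqI[OF assms(1-3)] by (metis (mono_tags, lifting) mem_Collect_eq)

lemma GL_orbits_conj_act:
  fixes g :: "'k::field mat3"
  assumes "invertible g" "conj_act g A \<in> GL_orbits X"
  shows "A \<in> GL_orbits X"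
proof -
  obtain h N where h: "invertible h" "N \<in> X" "conj_act g A = conj_act h N"
    using assms(2) unfolding GL_orbits_def by blast
  have "A = conj_act (matrix_inv g ** h) N"
    using h assms(1) by (metis conj_act_comp conj_act_inverse invertible_matrix_inv)
  then show ?thesis
    unfolding GL_orbits_def using h assms(1) invertible_mult invertible_matrix_inv by blast
qed

section \<open>Nilpotent pairs are triangularizable\<close>

lemma foldr_mult_append:
  "foldr (**) Ms (N::'k::field mat3) = foldr (**) Ms (mat 1) ** N"
  by (induction Ms) (simp_all add: matrix_mul_assoc)

text \<open>
  The flag consists of the line of \<open>v\<close> inside the kernel of \<open>f\<close>. In the new
  basis \<open>v\<close> is the last vector and \<open>f\<close> the first coordinate.
\<close>

lemma complete_flag:
  fixes v :: "'k::field^3" and f :: "'k^3"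
  assumes "v \<noteq> 0" "f \<noteq> 0" and orth: "f$1 * v$1 + f$2 * v$2 + f$3 * v$3 = 0"
  shows "\<exists>g::'k mat3. invertible g \<and> g$1 = f \<and> g *v v = vector [0, 0, 1]"
proof -
  have "\<exists>k. v$k \<noteq> 0" using \<open>v \<noteq> 0\<close> by (auto simp: vec_eq_iff)
  then have v: "v$1 \<noteq> 0 \<or> v$2 \<noteq> 0 \<or> v$3 \<noteq> 0" by (metis exhaust_3)
  have "\<exists>k. f$k \<noteq> 0" using \<open>f \<noteq> 0\<close> by (auto simp: vec_eq_iff)
  then have f: "f$1 \<noteq> 0 \<or> f$2 \<noteq> 0 \<or> f$3 \<noteq> 0" by (metis exhaust_3)
  define M where "M g1 g2 g3 h1 h2 h3 = mat_rows (f$1) (f$2) (f$3) g1 g2 g3 h1 h2 h3" for g1 g2 g3 h1 h2 h3 :: 'k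
  have M: ?thesis
    if "det (M g1 g2 g3 h1 h2 h3) \<noteq> 0"
       "g1 * v$1 + g2 * v$2 + g3 * v$3 = 0" "h1 * v$1 + h2 * v$2 + h3 * v$3 = 1"
    for g1 g2 g3 h1 h2 h3
  proof (intro exI conjI)
    show "invertible (M g1 g2 g3 h1 h2 h3)" using that(1) by (simp add: invertible_det_nz)
    show "M g1 g2 g3 h1 h2 h3 $ 1 = f" by (simp add: M_def vec_eq_iff forall_3)
    show "M g1 g2 g3 h1 h2 h3 *v v = vector [0, 0, 1]"
      using that orth by (simp add: M_def vec_eq_iff forall_3 matrix_vector_mult_def sum_3)
  qed
  \<comment> \<open>If \<open>v\<close> is nonzero in position \<open>k\<close>, orthogonality prevents \<open>f\<close> from being
      supported at \<open>k\<close> alone. The last row is then the \<open>k\<close>-th coordinate divided by \<open>v$k\<close>, and the middle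
      row corrects the remaining coordinate to vanish on \<open>v\<close>.\<close>
  consider "v$1 \<noteq> 0" "f$2 \<noteq> 0" | "v$1 \<noteq> 0" "f$3 \<noteq> 0" | "v$2 \<noteq> 0" "f$1 \<noteq> 0"
    | "v$2 \<noteq> 0" "f$3 \<noteq> 0" | "v$3 \<noteq> 0" "f$1 \<noteq> 0" | "v$3 \<noteq> 0" "f$2 \<noteq> 0"
    using v f orth by (metis add.right_neutral add_0 mult_eq_0_iff)
  then show ?thesis
  proof cases
    case 1 then show ?thesis
      by (intro M[of "- v$3/v$1" 0 1 "1/v$1" 0 0]) (simp_all add: M_def det_3)
  next
    case 2 then show ?thesis
      by (intro M[of "- v$2/v$1" 1 0 "1/v$1" 0 0]) (simp_all add: M_def det_3)
  next
    case 3 then show ?thesis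
      by (intro M[of 0 "- v$3/v$2" 1 0 "1/v$2" 0]) (simp_all add: M_def det_3)
  next
    case 4 then show ?thesis
      by (intro M[of 1 "- v$1/v$2" 0 0 "1/v$2" 0]) (simp_all add: M_def det_3)
  next
    case 5 then show ?thesis
      by (intro M[of 0 1 "- v$2/v$3" 0 0 "1/v$3"]) (simp_all add: M_def det_3)
  next
    case 6 then show ?thesis
      by (intro M[of 1 0 "- v$1/v$3" 0 0 "1/v$3"]) (simp_all add: M_def det_3)
  qed
qed

text \<open>
  A block triangular shape makes the middle diagonal entry multiplicative, so that nilpotency
  forces it to be zero. The entry at (1,2) is carried along for the induction.
\<close>

lemma power_diagonal_entry:
  fixes B :: "'k::field mat3"
  assumes "B$1$2 = 0" "B$1$1 = 0" "B$1$3 = 0" "B$2$3 = 0"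
  shows "foldr (**) (replicate n B) (mat 1) $ 2 $ 2 = B$2$2 ^ n \<and>
         foldr (**) (replicate n B) (mat 1) $ 1 $ 2 = 0"
  using assms by (induction n) (simp_all add: mult_entry, simp_all add: mat_def)

lemma foldr_replicate_conj:
  fixes g :: "'k::field mat3"
  assumes "B ** g = g ** A"
  shows "foldr (**) (replicate n B) (mat 1) ** g = g ** foldr (**) (replicate n A) (mat 1)"
proof (induction n)
  case (Suc n)
  then show ?case using assms by (simp flip: matrix_mul_assoc) (simp add: matrix_mul_assoc)
qed simp

text \<open>
  \<open>M\<close> is a nonzero product of maximal length, with at least one factor since the pair is
  not zero. Multiplying it by one more element of the algebra on either side gives zero, and
  \<open>M ** M\<close> vanishes because \<open>M\<close> itself starts with a factor from the algebra.
\<close>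

lemma nilpotent_pair_annihilator:
  fixes A :: "'k::field mat3 \<times> 'k mat3"
  assumes "A \<in> nilpotent_pairs" "A \<noteq> (0, 0)"
  obtains M where "M \<noteq> 0" "M ** M = 0" "fst A ** M = 0" "snd A ** M = 0" "M ** fst A = 0" "M ** snd A = 0"
proof -
  define S where "S = nonunital_subalgebra hull {fst A, snd A}"
  define kills where
    "kills n \<longleftrightarrow> (\<forall>Ms. length Ms = n \<and> set Ms \<subseteq> S \<longrightarrow> foldr (**) Ms (mat 1) = 0)" for n
  have S: "fst A \<in> S" "snd A \<in> S" unfolding S_def by (simp_all add: hull_inc)
  obtain n where "kills n"
    using assms(1) unfolding nilpotent_pairs_def nilpotent_algebra_def S_def kills_def by blast
  have "\<not> kills 0" by (auto simp: kills_def mat_eq_iff mat_def)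
  then obtain m where m: "\<not> kills m" "kills (Suc m)"
    using \<open>kills n\<close> by (induction n) auto
  have "m \<noteq> 0"
  proof
    assume "m = 0"
    then have "foldr (**) [N] (mat 1) = 0" if "N \<in> S" for N
      using m(2) that unfolding kills_def by (metis empty_subsetI insert_subset length_Cons list.set(1,2) list.size(3))
    then show False using S assms(2) by (simp add: prod_eq_iff)
  qed
  obtain Ms where Ms: "length Ms = m" "set Ms \<subseteq> S" and nz: "foldr (**) Ms (mat 1) \<noteq> 0"
    using m(1) unfolding kills_def by blast
  define M where "M = foldr (**) Ms (mat 1)"
  have left: "N ** M = 0" if "N \<in> S" for N
  proof -
    have "length (N # Ms) = Suc m \<and> set (N # Ms) \<subseteq> S" using Ms that by simp
    then have "foldr (**) (N # Ms) (mat 1) = 0" using m(2) unfolding kills_def by blast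
    then show ?thesis by (simp add: M_def)
  qed
  have right: "M ** N = 0" if "N \<in> S" for N
  proof -
    have "length (Ms @ [N]) = Suc m \<and> set (Ms @ [N]) \<subseteq> S" using Ms that by simp
    then have "foldr (**) (Ms @ [N]) (mat 1) = 0" using m(2) unfolding kills_def by blast
    then show ?thesis by (simp add: M_def foldr_mult_append[of Ms N])
  qed
  obtain N Ns where N: "Ms = N # Ns" using Ms(1) \<open>m \<noteq> 0\<close> by (cases Ms) auto
  have "M ** M = (M ** N) ** foldr (**) Ns (mat 1)" using N by (simp add: M_def matrix_mul_assoc)
  then have "M ** M = 0" using right[of N] Ms N by simp
  then show ?thesis using that[of M] nz left right S unfolding M_def by blast
qed

text \<open>
  Any nonzero column \<open>v\<close> of the annihilator \<open>M\<close> is a common kernel vector and any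
  nonzero row \<open>f\<close> a common left kernel vector; \<open>M ** M = 0\<close> makes them
  orthogonal. In a basis adapted to both, the first row and the last column of the pair vanish,
  and only the middle diagonal entry is left to be killed by nilpotency.
\<close>

lemma nilpotent_pair_triangularizable:
  fixes A :: "'k::field mat3 \<times> 'k mat3"
  assumes "A \<in> nilpotent_pairs"
  obtains g a1 b1 c1 a2 b2 c2 where "invertible g" "conj_act g A = (lower a1 b1 c1, lower a2 b2 c2)"
proof (cases "A = (0, 0)")
  case True
  then have "conj_act (mat 1) A = (lower 0 0 0, lower 0 0 0)"
    by (simp add: conj_act_one mat_eq_iff)
  then show ?thesis using that[of "mat 1"] by (metis invertible_def matrix_mul_lid)
next
  case False
  obtain M where M: "M \<noteq> 0" "M ** M = 0" "fst A ** M = 0" "snd A ** M = 0" "M ** fst A = 0" "M ** snd A = 0"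
    using nilpotent_pair_annihilator[OF assms False] by blast
  obtain i j where ij: "M $ i $ j \<noteq> 0" using \<open>M \<noteq> 0\<close> by (auto simp: vec_eq_iff)
  define v where "v = column j M"
  define f where "f = row i M"
  have "v \<noteq> 0" "f \<noteq> 0" using ij by (auto simp: v_def f_def column_def row_def vec_eq_iff)
  moreover have "f$1 * v$1 + f$2 * v$2 + f$3 * v$3 = 0"
  proof -
    have "f$1 * v$1 + f$2 * v$2 + f$3 * v$3 = (M ** M) $ i $ j"
      by (simp add: mult_entry v_def f_def column_def row_def)
    then show ?thesis using M(2) by simp
  qed
  ultimately obtain g :: "'k mat3" where g: "invertible g" "g$1 = f" "g *v v = vector [0, 0, 1]"
    using complete_flag[of v f] by blast
  define h where "h = matrix_inv g"
  have gh: "g ** h = mat 1" "h ** g = mat 1" using g(1) by (simp_all add: h_def matrix_inv_inverse)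
  have "h *v vector [0, 0, 1] = v"
    by (metis g(3) gh(2) matrix_vector_mul_assoc matrix_vector_mul_lid)
  then have hv: "h $ k $ 3 = v $ k" for k
    by (auto simp: vec_eq_iff matrix_vector_mult_def sum_3)
  have "\<exists>a b c. g ** N ** h = lower a b c"
    if N: "N ** M = 0" "M ** N = 0" "\<exists>n. foldr (**) (replicate n N) (mat 1) = 0" for N
  proof -
    have row1: "(g ** N) $ 1 $ k = 0" for k
    proof -
      have "(g ** N) $ 1 $ k = (M ** N) $ i $ k" by (simp add: mult_entry g(2) f_def row_def)
      then show ?thesis using N by simp
    qed
    have col3: "(N ** h) $ k $ 3 = 0" for k
    proof -
      have "(N ** h) $ k $ 3 = (N ** M) $ k $ j" by (simp add: mult_entry hv v_def column_def)
      then show ?thesis using N by simp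
    qed
    define B where "B = g ** N ** h"
    have r: "B $ 1 $ k = 0" for k unfolding B_def by (subst mult_entry) (simp add: row1)
    have c: "B $ k $ 3 = 0" for k
      unfolding B_def matrix_mul_assoc[symmetric] by (subst mult_entry) (simp add: col3)
    obtain n where n: "foldr (**) (replicate n N) (mat 1) = 0" using N(3) by blast
    have "B ** g = g ** N" unfolding B_def using gh by (simp flip: matrix_mul_assoc)
    then have "foldr (**) (replicate n B) (mat 1) ** g = 0"
      using n foldr_replicate_conj[of B g N n] by (simp del: foldr_replicate)
    then have "foldr (**) (replicate n B) (mat 1) ** g ** h = 0" by simp
    then have "foldr (**) (replicate n B) (mat 1) = 0" using gh by (simp flip: matrix_mul_assoc)
    then have "B $ 2 $ 2 ^ n = 0" using power_diagonal_entry[of B n] r c by simp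
    then have "B $ 2 $ 2 = 0" by simp
    then have "B = lower (B$2$1) (B$3$2) (B$3$1)" using r c by (simp add: mat_eq_iff)
    then show ?thesis unfolding B_def by blast
  qed
  moreover have "\<exists>n. foldr (**) (replicate n N) (mat 1) = 0" if "N \<in> {fst A, snd A}" for N
  proof -
    define S where "S = nonunital_subalgebra hull {fst A, snd A}"
    have "N \<in> S" using that by (auto simp: S_def hull_inc)
    moreover obtain n where
      n: "\<And>Ms. length Ms = n \<and> set Ms \<subseteq> S \<Longrightarrow> foldr (**) Ms (mat 1) = 0"
      using assms unfolding nilpotent_pairs_def nilpotent_algebra_def S_def by blast
    ultimately have "foldr (**) (replicate n N) (mat 1) = 0"
      by (intro n) (auto simp: set_replicate_conv_if)
    then show ?thesis ..
  qed
  ultimately have "\<exists>a b c. g ** fst A ** h = lower a b c" "\<exists>a b c. g ** snd A ** h = lower a b c"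
    using M by simp_all
  then obtain a1 b1 c1 a2 b2 c2
    where "g ** fst A ** h = lower a1 b1 c1" "g ** snd A ** h = lower a2 b2 c2"
    by blast
  then show ?thesis using that g(1) by (simp add: conj_act_def h_def)
qed

section \<open>Normal forms of triangular pairs\<close>

lemma lower_mult: "lower a b c ** lower a' b' c' = lower 0 0 (b * a')"
  by (simp add: mat_eq_iff mult_entry)

text \<open>
  The equations say that \<open>mat_rows p 0 0 x q 0 0 y r\<close> intertwines the two pairs. The
  diagonal rescales \<open>a\<close> and \<open>b\<close>; the entries \<open>x\<close> and
  \<open>y\<close> change \<open>c\<close> by multiples of \<open>b\<close> and \<open>a\<close>.
\<close>

lemma lower_conj:
  fixes p q r :: "'k::field"
  assumes "p \<noteq> 0" "q \<noteq> 0" "r \<noteq> 0"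
    and "a1 * p = q * a1'" "a2 * p = q * a2'" "b1 * q = r * b1'" "b2 * q = r * b2'"
    and "c1 * p + b1 * x = y * a1' + r * c1'" "c2 * p + b2 * x = y * a2' + r * c2'"
    and "(lower a1' b1' c1', lower a2' b2' c2') \<in> X"
  shows "(lower a1 b1 c1, lower a2 b2 c2) \<in> GL_orbits X"
proof (rule GL_orbitsI)
  show "invertible (mat_rows p 0 0 x q 0 0 y r)"
    using assms(1-3) by (simp add: invertible_det_nz det_3)
  show "lower a1 b1 c1 ** mat_rows p 0 0 x q 0 0 y r = mat_rows p 0 0 x q 0 0 y r ** lower a1' b1' c1'"
    using assms by (simp add: mat_eq_iff mult_entry)
  show "lower a2 b2 c2 ** mat_rows p 0 0 x q 0 0 y r = mat_rows p 0 0 x q 0 0 y r ** lower a2' b2' c2'"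
    using assms by (simp add: mat_eq_iff mult_entry)
qed fact

text \<open>
  Cramer's rule: when \<open>a\<close> and \<open>b\<close> are independent they span the plane, and so
  \<open>c\<close> can be removed.
\<close>

lemma clear_corner:
  fixes a1 a2 b1 b2 c1 c2 :: "'k::field"
  assumes "a1 * b2 \<noteq> a2 * b1"
  obtains x y where "c1 + b1 * x = y * a1" "c2 + b2 * x = y * a2"
proof
  define d where "d = a1 * b2 - a2 * b1"
  have "d \<noteq> 0" using assms by (simp add: d_def)
  show "c1 + b1 * ((c1 * a2 - c2 * a1) / d) = ((c1 * b2 - c2 * b1) / d) * a1"
    using \<open>d \<noteq> 0\<close> by (simp add: field_simps) (simp add: d_def algebra_simps)
  show "c2 + b2 * ((c1 * a2 - c2 * a1) / d) = ((c1 * b2 - c2 * b1) / d) * a2"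
    using \<open>d \<noteq> 0\<close> by (simp add: field_simps) (simp add: d_def algebra_simps)
qed

definition regular_forms :: "('k::field mat3 \<times> 'k mat3) set" where
  "regular_forms = {pair_A l m | l m. m \<noteq> 0} \<union> {pair_A_fin_inf l | l. True} \<union>
                {pair_A_inf_fin l | l. True} \<union> {pair_B l m | l m. True} \<union>
                {pair_B_inf_fin l | l. True}"

lemma regular_formsI:
  "m \<noteq> l \<Longrightarrow> (lower 1 1 0, lower l m 0) \<in> regular_forms"
  "(lower 1 0 0, lower l 1 0) \<in> regular_forms"
  "(lower 0 1 0, lower 1 l 0) \<in> regular_forms"
  "(lower 1 1 0, lower l l m) \<in> regular_forms"
  "(lower 0 0 l, lower 1 1 0) \<in> regular_forms"
proof -
  show "(lower 1 1 0, lower l m 0) \<in> regular_forms" if "m \<noteq> l"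
  proof -
    have "(lower 1 1 0, lower l m 0) = pair_A l (m - l)" by (simp add: normal_forms_lower)
    moreover have "m - l \<noteq> 0" using that by simp
    ultimately show ?thesis unfolding regular_forms_def by blast
  qed
  show "(lower 1 0 0, lower l 1 0) \<in> regular_forms"
    unfolding regular_forms_def normal_forms_lower(2)[symmetric] by blast
  show "(lower 0 1 0, lower 1 l 0) \<in> regular_forms"
    unfolding regular_forms_def normal_forms_lower(3)[symmetric] by blast
  show "(lower 1 1 0, lower l l m) \<in> regular_forms"
    unfolding regular_forms_def normal_forms_lower(4)[symmetric] by blast
  show "(lower 0 0 l, lower 1 1 0) \<in> regular_forms"
    unfolding regular_forms_def normal_forms_lower(5)[symmetric] by blast
qed

text \<open>
  Each case chooses the diagonal so that the first nonzero entries of \<open>a\<close> and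
  \<open>b\<close> become 1. For dependent \<open>a\<close> and \<open>b\<close> only the line they
  span can be removed from \<open>c\<close>; one coordinate of \<open>c\<close> remains, which is
  the second parameter of the family \<open>B\<close>.
\<close>

lemma lower_pair_regular:
  fixes a1 a2 b1 b2 c1 c2 :: "'k::field"
  assumes "a1 \<noteq> 0 \<or> a2 \<noteq> 0" "b1 \<noteq> 0 \<or> b2 \<noteq> 0"
  shows "(lower a1 b1 c1, lower a2 b2 c2) \<in> GL_orbits regular_forms"
proof (cases "a1 * b2 = a2 * b1")
  case False
  obtain x y where xy: "c1 + b1 * x = y * a1" "c2 + b2 * x = y * a2"
    using clear_corner[OF False] by blast
  consider "a1 \<noteq> 0" "b1 \<noteq> 0" | "b1 = 0" "a1 \<noteq> 0" "b2 \<noteq> 0" | "a1 = 0" "a2 \<noteq> 0" "b1 \<noteq> 0"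
    using False by (cases "a1 = 0"; cases "b1 = 0") auto
  then show ?thesis
  proof cases
    case 1
    then have "b2/b1 \<noteq> a2/a1" using False by (simp add: field_simps)
    with 1 show ?thesis
      by (intro lower_conj[of 1 a1 "a1*b1" a1 1 a2 "a2/a1" b1 1 b2 "b2/b1" c1 x "y*a1" 0 c2 0]
          regular_formsI) (simp_all add: xy)
  next
    case 2
    then show ?thesis
      using xy by (intro lower_conj[of 1 a1 "a1*b2" a1 1 a2 "a2/a1" b1 0 b2 1 c1 x "y*a1" 0 c2 0]
          regular_formsI) auto
  next
    case 3
    then show ?thesis
      by (intro lower_conj[of 1 a2 "a2*b1" a1 0 a2 1 b1 1 b2 "b2/b1" c1 x "y*a2" 0 c2 0]
          regular_formsI) (simp_all add: xy)
  qed
next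
  case True
  then consider "a1 \<noteq> 0" "b1 \<noteq> 0" | "a1 = 0" "b1 = 0" "a2 \<noteq> 0" "b2 \<noteq> 0"
    using assms by (cases "a1 = 0"; cases "b1 = 0") auto
  then show ?thesis
  proof cases
    case 1
    have dep: "b2 * a1 = b1 * a2" using True by (simp add: mult.commute)
    show ?thesis
      using 1 by (intro lower_conj[of 1 a1 "a1*b1" a1 1 a2 "a2/a1" b1 1 b2 "a2/a1" c1 0 c1 0 c2
            "(c2 - c1*(a2/a1))/(a1*b1)"] regular_formsI) (simp_all add: dep)
  next
    case 2
    then show ?thesis
      by (intro lower_conj[of 1 a2 "a2*b2" a1 0 a2 1 b1 0 b2 1 c1 0 c2 "c1/(a2*b2)" c2 0]
          regular_formsI) simp_all
  qed
qed

text \<open>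
  Intertwining requires the upper left block of \<open>g\<close>, multiplied from the right, to send the
  row vectors \<open>(c\<^sub>i, b\<^sub>i)\<close> to multiples of the unit vectors. This block is the adjugate of the matrix with these rows, and
  the entry \<open>d\<close> at (3,3) compensates for the determinant.
\<close>

lemma row_pair_independent:
  fixes b1 b2 c1 c2 :: "'k::field"
  assumes "c1 * b2 \<noteq> c2 * b1"
  shows "(lower 0 b1 c1, lower 0 b2 c2) \<in> GL_orbits {pair_D}"
proof -
  define d where "d = c1 * b2 - c2 * b1"
  have d: "d \<noteq> 0" using assms by (simp add: d_def)
  define g where "g = mat_rows b2 (-b1) 0 (-c2) c1 0 0 0 d"
  have "invertible g" using d by (simp add: g_def invertible_det_nz det_3) (simp add: d_def algebra_simps)
  then show ?thesis
    by (rule GL_orbitsI[of _ _ "lower 0 0 1" _ "lower 0 1 0"])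
      (simp_all add: g_def mat_eq_iff mult_entry normal_forms_lower d_def algebra_simps)
qed

lemma column_pair_independent:
  fixes a1 a2 c1 c2 :: "'k::field"
  assumes "a1 * c2 \<noteq> a2 * c1"
  shows "(lower a1 0 c1, lower a2 0 c2) \<in> GL_orbits {pair_C}"
proof (rule GL_orbitsI[of _ _ "lower 1 0 0" _ "lower 0 0 1"])
  show "invertible (mat_rows 1 0 0 0 a1 a2 0 c1 c2)"
    using assms by (simp add: invertible_det_nz det_3)
qed (simp_all add: mat_eq_iff mult_entry normal_forms_lower)

abbreviation (input) rank_one_forms :: "('k::field mat3 \<times> 'k mat3) set" where
  "rank_one_forms \<equiv> {pair_E l | l. True} \<union> {pair_E_inf}"

lemma rank_one_formsI: "s1 = 1 \<or> s1 = 0 \<and> s2 = 1 \<Longrightarrow> (lower s1 0 0, lower s2 0 0) \<in> rank_one_forms"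
  by (elim disjE conjE) (auto simp flip: normal_forms_lower(8,9))

text \<open>
  Dependent vectors \<open>(x1, y1)\<close> and \<open>(x2, y2)\<close> are multiples of a common
  one, and its scale is fixed by normalizing the point \<open>(s1 : s2)\<close> of the projective
  line; these two normalizations are the pairs \<open>E\<^sub>\<lambda>\<close> and \<open>E\<^sub>\<infinity>\<close>.
\<close>

lemma dependent_normalized:
  fixes x1 x2 y1 y2 :: "'k::field"
  assumes "x1 * y2 = x2 * y1" "\<not> (x1 = 0 \<and> x2 = 0 \<and> y1 = 0 \<and> y2 = 0)"
  obtains s1 s2 x y where "s1 = 1 \<or> s1 = 0 \<and> s2 = 1" "x \<noteq> 0 \<or> y \<noteq> 0"
    "x1 = s1 * x" "x2 = s2 * x" "y1 = s1 * y" "y2 = s2 * y"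
proof -
  consider "x1 \<noteq> 0" | "y1 \<noteq> 0" | "x1 = 0" "y1 = 0" by blast
  then show ?thesis
  proof cases
    case 1 then show ?thesis using assms that[of 1 "x2/x1" x1 y1] by (simp add: field_simps)
  next
    case 2 then show ?thesis using assms that[of 1 "y2/y1" x1 y1] by (simp add: field_simps)
  next
    case 3 then show ?thesis using assms that[of 0 1 x2 y2] by auto
  qed
qed

text \<open>
  Both matrices are multiples of one matrix of rank one, with image spanned by the third basis
  vector and row factor \<open>(c, b, 0)\<close>. The columns of \<open>g\<close> are a vector on
  which this row factor is 1, the image, and a vector that completes the kernel.
\<close>

lemma row_pair_dependent:
  fixes b1 b2 c1 c2 :: "'k::field"
  assumes "c1 * b2 = c2 * b1" "\<not> (c1 = 0 \<and> c2 = 0 \<and> b1 = 0 \<and> b2 = 0)"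
  shows "(lower 0 b1 c1, lower 0 b2 c2) \<in> GL_orbits rank_one_forms"
proof -
  obtain s1 s2 c b where s: "s1 = 1 \<or> s1 = 0 \<and> s2 = 1" and cb: "c \<noteq> 0 \<or> b \<noteq> 0"
    and eqs: "c1 = s1 * c" "c2 = s2 * c" "b1 = s1 * b" "b2 = s2 * b"
    by (rule dependent_normalized[OF assms])
  show ?thesis
  proof (cases "c = 0")
    case False
    define g where "g = mat_rows (1/c) 0 (-b/c) 0 0 1 0 1 0"
    have "invertible g" using False by (simp add: g_def invertible_det_nz det_3)
    then show ?thesis
      by (rule GL_orbitsI[OF _ _ _ rank_one_formsI[OF s]])
        (use False in \<open>simp_all add: g_def mat_eq_iff mult_entry eqs\<close>)
  next
    case True
    define g where "g = mat_rows 0 0 1 (1/b) 0 0 0 1 0"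
    have "invertible g" using True cb by (simp add: g_def invertible_det_nz det_3)
    then show ?thesis
      by (rule GL_orbitsI[OF _ _ _ rank_one_formsI[OF s]])
        (use True cb in \<open>simp_all add: g_def mat_eq_iff mult_entry eqs\<close>)
  qed
qed

lemma column_pair_dependent:
  fixes a1 a2 c1 c2 :: "'k::field"
  assumes "a1 * c2 = a2 * c1" "\<not> (a1 = 0 \<and> a2 = 0 \<and> c1 = 0 \<and> c2 = 0)"
  shows "(lower a1 0 c1, lower a2 0 c2) \<in> GL_orbits rank_one_forms"
proof -
  obtain s1 s2 a c where s: "s1 = 1 \<or> s1 = 0 \<and> s2 = 1" and ac: "a \<noteq> 0 \<or> c \<noteq> 0"
    and eqs: "a1 = s1 * a" "a2 = s2 * a" "c1 = s1 * c" "c2 = s2 * c"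
    by (rule dependent_normalized[OF assms])
  define g where "g = (if a \<noteq> 0 then mat_rows 1 0 0 0 a 0 0 c 1 else mat_rows 1 0 0 0 a 1 0 c 0)"
  have "invertible g" using ac by (simp add: g_def invertible_det_nz det_3)
  then show ?thesis
    by (rule GL_orbitsI[OF _ _ _ rank_one_formsI[OF s]])
      (simp_all add: g_def mat_eq_iff mult_entry eqs)
qed

lemma nilpotent_pair_cases:
  fixes A :: "'k::field mat3 \<times> 'k mat3"
  assumes "A \<in> nilpotent_pairs"
  shows "A \<in> GL_orbits {pair_O} \<union> GL_orbits rank_one_forms \<union> GL_orbits {pair_D} \<union>
    GL_orbits {pair_C} \<union> GL_orbits regular_forms"
proof -
  obtain g a1 b1 c1 a2 b2 c2
    where g: "invertible g" and L: "conj_act g A = (lower a1 b1 c1, lower a2 b2 c2)"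
    using nilpotent_pair_triangularizable[OF assms] by metis
  have one: "invertible (mat 1 :: 'k mat3)" by (metis invertible_def matrix_mul_lid)
  have zero: "(lower 0 0 0, lower 0 0 0 :: 'k mat3) \<in> GL_orbits {pair_O}"
    by (rule GL_orbitsI[OF one]) (simp_all add: normal_forms_lower)
  have "conj_act g A \<in> GL_orbits {pair_O} \<union> GL_orbits rank_one_forms \<union> GL_orbits {pair_D} \<union>
    GL_orbits {pair_C} \<union> GL_orbits regular_forms"
  proof (cases "a1 = 0 \<and> a2 = 0")
    case a: True
    show ?thesis
      using row_pair_independent[of c1 b2 c2 b1] row_pair_dependent[of c1 b2 c2 b1] a zero
      unfolding L by (cases "c1 = 0 \<and> c2 = 0 \<and> b1 = 0 \<and> b2 = 0") auto
  next
    case a: False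
    show ?thesis
    proof (cases "b1 = 0 \<and> b2 = 0")
      case True
      then show ?thesis
        using column_pair_independent[of a1 c2 a2 c1] column_pair_dependent[of a1 c2 a2 c1] a
        unfolding L by blast
    next
      case False
      then show ?thesis using lower_pair_regular a unfolding L by blast
    qed
  qed
  then show ?thesis using GL_orbits_conj_act[OF g] by blast
qed

section \<open>Orbits of triangular pairs are nilpotent\<close>

text \<open>
  The conjugates by \<open>g\<close> of strictly lower triangular matrices form a subalgebra in which all products of
  three factors vanish, and it contains the generated algebra.
\<close>

lemma conj_lower_nilpotent:
  fixes g :: "'k::field mat3"
  assumes g: "invertible g"
  shows "conj_act g (lower a1 b1 c1, lower a2 b2 c2) \<in> nilpotent_pairs"
proof -
  define T where "T = {M. \<exists>a b c. M ** g = g ** lower a b c}"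
  define h where "h = matrix_inv g"
  have gh: "g ** h = mat 1" "h ** g = mat 1" using g by (simp_all add: h_def matrix_inv_inverse)
  have sub: "nonunital_subalgebra T"
    unfolding nonunital_subalgebra_def
  proof (intro conjI ballI allI)
    have "0 ** g = g ** lower 0 0 0" by (simp add: mat_eq_iff mult_entry)
    then show "0 \<in> T" unfolding T_def by blast
  next
    fix A B assume "A \<in> T" "B \<in> T"
    then obtain a b c a' b' c' where *: "A ** g = g ** lower a b c" "B ** g = g ** lower a' b' c'"
      unfolding T_def by blast
    have "(A + B) ** g = A ** g + B ** g" by (simp add: mat_eq_iff mult_entry algebra_simps)
    also have "\<dots> = g ** lower (a+a') (b+b') (c+c')"
      unfolding * by (simp add: mat_eq_iff mult_entry algebra_simps)
    finally show "A + B \<in> T" unfolding T_def by blast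
    have "A ** B ** g = (A ** g) ** lower a' b' c'" using *(2) by (simp flip: matrix_mul_assoc)
    also have "\<dots> = g ** lower 0 0 (b * a')"
      unfolding *(1) matrix_mul_assoc[symmetric] lower_mult ..
    finally show "A ** B \<in> T" unfolding T_def by blast
  next
    fix s A assume "A \<in> T"
    then obtain a b c where *: "A ** g = g ** lower a b c" unfolding T_def by blast
    have "(s *m A) ** g = s *m (A ** g)"
      by (simp add: mat_eq_iff mult_entry mat_smult_def map_matrix_def algebra_simps)
    also have "\<dots> = g ** lower (s * a) (s * b) (s * c)"
      unfolding * by (simp add: mat_eq_iff mult_entry mat_smult_def map_matrix_def algebra_simps)
    finally show "s *m A \<in> T" unfolding T_def by blast
  qed
  have mem: "g ** lower a b c ** h \<in> T" for a b c
    unfolding T_def using gh by (simp flip: matrix_mul_assoc) blast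
  have hull: "nonunital_subalgebra hull {g ** lower a1 b1 c1 ** h, g ** lower a2 b2 c2 ** h} \<subseteq> T"
    by (rule hull_minimal) (use sub mem in auto)
  have "nilpotent_algebra (nonunital_subalgebra hull {g ** lower a1 b1 c1 ** h, g ** lower a2 b2 c2 ** h})"
    unfolding nilpotent_algebra_def
  proof (intro exI[of _ 3] conjI allI impI)
    fix Ms assume Ms: "length Ms = 3 \<and> set Ms \<subseteq> nonunital_subalgebra hull {g ** lower a1 b1 c1 ** h, g ** lower a2 b2 c2 ** h}"
    then obtain M N P where MNP: "Ms = [M, N, P]"
      by (auto simp: length_Suc_conv numeral_3_eq_3)
    then have "M \<in> T" "N \<in> T" "P \<in> T" using Ms hull by auto
    then obtain a b c a' b' c' a'' b'' c'' where *: "M ** g = g ** lower a b c"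
      "N ** g = g ** lower a' b' c'" "P ** g = g ** lower a'' b'' c''"
      unfolding T_def by blast
    have "M ** N ** P ** g = M ** (N ** (g ** lower a'' b'' c''))"
      using *(3) by (simp flip: matrix_mul_assoc)
    also have "\<dots> = M ** ((N ** g) ** lower a'' b'' c'')" by (simp add: matrix_mul_assoc)
    also have "\<dots> = M ** (g ** lower 0 0 (b' * a''))"
      unfolding *(2) by (simp only: matrix_mul_assoc[symmetric] lower_mult)
    also have "\<dots> = g ** (lower a b c ** lower 0 0 (b' * a''))"
      using *(1) by (simp add: matrix_mul_assoc)
    also have "\<dots> = 0" unfolding lower_mult by (simp add: mat_eq_iff mult_entry)
    finally have "M ** N ** P ** g ** h = 0" by simp
    then have "M ** N ** P = 0" using gh by (simp flip: matrix_mul_assoc)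
    then show "foldr (**) Ms (mat 1) = 0" using MNP by (simp add: matrix_mul_assoc)
  qed simp
  then show ?thesis by (simp add: nilpotent_pairs_def conj_act_def h_def)
qed

section \<open>Lower bounds for admissible weights\<close>

definition sqnorm :: "rat^3 \<Rightarrow> rat" where
  "sqnorm b = (b$1)^2 + (b$2)^2 + (b$3)^2"

lemma sqnorm_rearranged:
  fixes i j k :: 3
  assumes "i \<noteq> j" "j \<noteq> k" "i \<noteq> k"
  shows "sqnorm b = (b$i)^2 + (b$j)^2 + (b$k)^2"
    and "increasing_rearrangement b = sort [b$i, b$j, b$k]"
proof -
  have "{#b$1, b$2, b$3#} = {#b$i, b$j, b$k#}"
    using assms exhaust_3[of i] exhaust_3[of j] exhaust_3[of k] by (auto simp: add_mset_commute)
  then show "increasing_rearrangement b = sort [b$i, b$j, b$k]"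
    unfolding increasing_rearrangement_def by (intro properties_for_sort) auto
  show "sqnorm b = (b$i)^2 + (b$j)^2 + (b$k)^2"
    using assms exhaust_3[of i] exhaust_3[of j] exhaust_3[of k] by (auto simp: sqnorm_def)
qed

lemma third_index:
  fixes i j :: 3
  obtains k where "k \<noteq> i" "k \<noteq> j"
proof -
  have "(1 \<noteq> i \<and> 1 \<noteq> j) \<or> (2 \<noteq> i \<and> 2 \<noteq> j) \<or> (3 \<noteq> i \<and> 3 \<noteq> j)"
    using exhaust_3[of i] exhaust_3[of j] by (elim disjE) simp_all
  then show ?thesis using that by blast
qed

text \<open>
  The bounds below share one idea. Write the gaps between coordinates as their least allowed
  values plus nonnegative slacks and complete the square in what remains: the norm becomes the
  claimed minimum plus nonnegative terms, whose joint vanishing determines all coordinates.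
\<close>

lemma edge_bound:
  assumes "b$i - b$j \<ge> 1"
  shows "1/2 \<le> sqnorm b \<and> (sqnorm b = 1/2 \<longrightarrow> increasing_rearrangement b = [-1/2, 0, 1/2])"
proof -
  have "i \<noteq> j" using assms by auto
  obtain k where k: "k \<noteq> i" "k \<noteq> j" by (rule third_index)
  have "sqnorm b = (b$j)^2 + (b$k)^2 + (b$i)^2" and inc: "increasing_rearrangement b = sort [b$j, b$k, b$i]"
    using sqnorm_rearranged[of j k i] k \<open>i \<noteq> j\<close> by auto
  obtain u where u: "u \<ge> 0" "b$i = b$j + 1 + u" using assms that[of "b$i - b$j - 1"] by simp
  have eq: "sqnorm b = 1/2 + 2 * (b$j + (1+u)/2)^2 + (b$k)^2 + u^2/2 + u"
    unfolding \<open>sqnorm b = _\<close> u by (simp add: power2_eq_square field_simps)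
  show ?thesis
  proof (intro conjI impI)
    show "1/2 \<le> sqnorm b" unfolding eq using u(1) by simp
    assume "sqnorm b = 1/2"
    then have "2 * (b$j + (1+u)/2)^2 + (b$k)^2 + u^2/2 + u = 0" using eq by simp
    then have "u = 0" "(b$k)^2 = 0" "(b$j + (1+u)/2)^2 = 0"
      using u(1) zero_le_power2[of "b$j + (1+u)/2"] zero_le_power2[of "b$k"] zero_le_power2[of u]
      by linarith+
    then have "b$j = -1/2" "b$k = 0" "b$i = 1/2" using u by simp_all
    then show "increasing_rearrangement b = [-1/2, 0, 1/2]" using inc by simp
  qed
qed

lemma source_bound:
  fixes x y z :: rat
  assumes "y - x \<ge> 1" "z - x \<ge> 1"
  shows "2/3 \<le> x^2 + y^2 + z^2 \<and> (x^2 + y^2 + z^2 = 2/3 \<longrightarrow> x = -2/3 \<and> y = 1/3 \<and> z = 1/3)"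
proof -
  obtain u where u: "u \<ge> 0" "y = x + 1 + u" using assms that[of "y - x - 1"] by simp
  obtain v where v: "v \<ge> 0" "z = x + 1 + v" using assms that[of "z - x - 1"] by simp
  have eq: "x^2 + y^2 + z^2 = 2/3 + 3 * (x + 2/3 + (u+v)/3)^2 + (2/3) * ((u-v)^2 + u * v + u + v)"
    unfolding u(2) v(2) by (simp add: power2_eq_square field_simps)
  have nn: "0 \<le> (x + 2/3 + (u+v)/3)^2" "0 \<le> (u-v)^2" "0 \<le> u * v" using u v by simp_all
  show ?thesis
  proof (intro conjI impI)
    show "2/3 \<le> x^2 + y^2 + z^2" unfolding eq using nn u(1) v(1) by simp
    assume "x^2 + y^2 + z^2 = 2/3"
    then have "3 * (x + 2/3 + (u+v)/3)^2 + (2/3) * ((u-v)^2 + u * v + u + v) = 0" using eq by linarith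
    moreover have "u = 0 \<and> v = 0 \<and> s = 0"
      if "3 * s + (2/3) * (d + p + u + v) = 0" "0 \<le> s" "0 \<le> d" "0 \<le> p" for s d p :: rat
      using that u(1) v(1) by (simp add: add_nonneg_eq_0_iff)
    ultimately have "u = 0 \<and> v = 0 \<and> (x + 2/3 + (u+v)/3)^2 = 0" using nn by blast
    then have "u = 0" "v = 0" "(x + 2/3 + (u+v)/3)^2 = 0" by blast+
    then show "x = -2/3" "y = 1/3" "z = 1/3" using u v by simp_all
  qed
qed

lemma fork_bound:
  assumes "b$i - b$j \<ge> 1" "b$k - b$j \<ge> 1" "i \<noteq> k"
  shows "2/3 \<le> sqnorm b \<and> (sqnorm b = 2/3 \<longrightarrow> increasing_rearrangement b = [-2/3, 1/3, 1/3])"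
proof -
  have "j \<noteq> i" "j \<noteq> k" using assms by auto
  then show ?thesis
    using source_bound[OF assms(1,2)] assms(3) by (auto simp: sqnorm_rearranged[of j i k])
qed

text \<open>
  Negating the weight turns two entries in one row into two entries in one column.
\<close>

lemma cofork_bound:
  assumes "b$i - b$j \<ge> 1" "b$i - b$k \<ge> 1" "j \<noteq> k"
  shows "2/3 \<le> sqnorm b \<and> (sqnorm b = 2/3 \<longrightarrow> increasing_rearrangement b = [-1/3, -1/3, 2/3])"
proof -
  have "j \<noteq> i" "k \<noteq> i" using assms by auto
  have neg: "- b$j - (- b$i) \<ge> 1" "- b$k - (- b$i) \<ge> 1" using assms by simp_all
  have "2/3 \<le> sqnorm b \<and> (sqnorm b = 2/3 \<longrightarrow> b$i = 2/3 \<and> b$j = -1/3 \<and> b$k = -1/3)"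
    using source_bound[OF neg] sqnorm_rearranged(1)[of i j k] \<open>j \<noteq> k\<close> \<open>j \<noteq> i\<close> \<open>k \<noteq> i\<close>
    by auto
  then show ?thesis
    unfolding sqnorm_rearranged(2)[OF \<open>j \<noteq> k\<close> \<open>k \<noteq> i\<close> \<open>j \<noteq> i\<close>] by auto
qed

lemma chain_bound:
  assumes "b$i - b$j \<ge> 1" "b$j - b$k \<ge> 1"
  shows "2 \<le> sqnorm b \<and> (sqnorm b = 2 \<longrightarrow> increasing_rearrangement b = [-1, 0, 1])"
proof -
  have ne: "k \<noteq> j" "j \<noteq> i" "k \<noteq> i" using assms by auto
  have "sqnorm b = (b$k)^2 + (b$j)^2 + (b$i)^2" and inc: "increasing_rearrangement b = sort [b$k, b$j, b$i]"
    using sqnorm_rearranged[of k j i] ne by auto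
  obtain u where u: "u \<ge> 0" "b$j = b$k + 1 + u" using assms that[of "b$j - b$k - 1"] by simp
  obtain v where v: "v \<ge> 0" "b$i = b$k + 2 + u + v" using assms that[of "b$i - b$j - 1"] u by simp
  have eq: "sqnorm b = 2 + 3 * (b$k + 1 + (2 * u + v)/3)^2 + (2/3) * (3 * u + 3 * v + u^2 + u * v + v^2)"
    unfolding \<open>sqnorm b = _\<close> u(2) v(2) by (simp add: power2_eq_square field_simps)
  have nn: "0 \<le> (b$k + 1 + (2 * u + v)/3)^2" "0 \<le> u^2" "0 \<le> v^2" "0 \<le> u * v" using u v by simp_all
  show ?thesis
  proof (intro conjI impI)
    show "2 \<le> sqnorm b" unfolding eq using nn u(1) v(1) by simp
    assume "sqnorm b = 2"
    then have "3 * (b$k + 1 + (2 * u + v)/3)^2 + (2/3) * (3 * u + 3 * v + u^2 + u * v + v^2) = 0" using eq by linarith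
    moreover have "u = 0 \<and> v = 0 \<and> s = 0"
      if "3 * s + (2/3) * (3 * u + 3 * v + d + p + e) = 0" "0 \<le> s" "0 \<le> d" "0 \<le> e" "0 \<le> p" for s d p e :: rat
      using that u(1) v(1) by (simp add: add_nonneg_eq_0_iff)
    ultimately have "u = 0 \<and> v = 0 \<and> (b$k + 1 + (2 * u + v)/3)^2 = 0" using nn by blast
    then have "u = 0" "v = 0" "(b$k + 1 + (2 * u + v)/3)^2 = 0" by blast+
    then have "b$k = -1" "b$j = 0" "b$i = 1" using u v by simp_all
    then show "increasing_rearrangement b = [-1, 0, 1]" using inc by simp
  qed
qed

section \<open>The strata of the normal forms\<close>

text \<open>
  Since the bound ranges over all conjugates, it need only be checked for the representative
  \<open>X\<close>: the pairs competing for \<open>conj_act g X\<close> are those for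
  \<open>X\<close>, translated by \<open>g\<close>.
\<close>

lemma hesselink_stratumI:
  fixes g :: "'k::field mat3"
  assumes X: "X = (lower a1 b1 c1, lower a2 b2 c2)" and g: "invertible g"
    and adm: "admissible b0 X"
    and bound: "\<And>h b. invertible h \<Longrightarrow> admissible b (conj_act h X) \<Longrightarrow>
      sqnorm b0 \<le> sqnorm b \<and> (sqnorm b = sqnorm b0 \<longrightarrow> increasing_rearrangement b = \<beta>)"
  shows "conj_act g X \<in> hesselink_stratum \<beta>"
proof -
  have bound': "sqnorm b0 \<le> sqnorm b \<and> (sqnorm b = sqnorm b0 \<longrightarrow> increasing_rearrangement b = \<beta>)"
    if "invertible h" "admissible b (conj_act h (conj_act g X))" for h b
    using that g bound[of "h ** g" b] by (simp add: conj_act_comp invertible_mult)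
  have inv: "invertible (matrix_inv g)" "conj_act (matrix_inv g) (conj_act g X) = X"
    using g by (simp_all add: invertible_matrix_inv conj_act_inverse)
  have mp: "minimizing_pair (conj_act g X) (h, b) \<longleftrightarrow>
      invertible h \<and> admissible b (conj_act h (conj_act g X)) \<and>
      (\<forall>h' b'. invertible h' \<and> admissible b' (conj_act h' (conj_act g X)) \<longrightarrow> sqnorm b \<le> sqnorm b')" for h b
    unfolding minimizing_pair_def is_arg_min_def sqnorm_def by (auto simp: not_less)
  have "minimizing_pair (conj_act g X) (matrix_inv g, b0)"
    unfolding mp using inv adm bound' by auto
  moreover have "increasing_rearrangement b = \<beta>" if "minimizing_pair (conj_act g X) (h, b)" for h b
  proof -
    have "sqnorm b \<le> sqnorm b0" using that inv adm unfolding mp by metis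
    then show ?thesis using bound'[of h b] that unfolding mp by auto
  qed
  ultimately show ?thesis
    unfolding hesselink_stratum_def using conj_lower_nilpotent[OF g] X by blast
qed

lemma GL_orbits_stratum_rank_one:
  "GL_orbits rank_one_forms \<subseteq> (hesselink_stratum [-1/2, 0, 1/2] :: ('k::field mat3 \<times> 'k mat3) set)"
proof
  fix A :: "'k mat3 \<times> 'k mat3" assume "A \<in> GL_orbits rank_one_forms"
  then obtain g X where g: "invertible g" and A: "A = conj_act g X" and "X \<in> rank_one_forms"
    unfolding GL_orbits_def by blast
  then obtain s1 s2 where X: "X = (lower s1 0 0, lower s2 0 0)" and s: "s1 \<noteq> 0 \<or> s2 \<noteq> 0"
    by (auto simp: normal_forms_lower)
  show "A \<in> hesselink_stratum [-1/2, 0, 1/2]"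
    unfolding A
  proof (rule hesselink_stratumI[OF X g])
    show "admissible (vector [-1/2, 1/2, 0]) X" by (simp add: admissible_def X forall_3)
    fix h :: "'k mat3" and b assume h: "invertible h" and b: "admissible b (conj_act h X)"
    have "conj_act h X \<noteq> (0, 0)"
    proof
      assume "conj_act h X = (0, 0)"
      then have "X = conj_act (matrix_inv h) (0, 0)" using conj_act_inverse[OF h] by metis
      then show False using X s by (auto simp: conj_act_def mat_eq_iff)
    qed
    then obtain i j where "fst (conj_act h X) $ i $ j \<noteq> 0 \<or> snd (conj_act h X) $ i $ j \<noteq> 0"
      by (metis prod.collapse vec_eq_iff zero_index)
    then have "b$i - b$j \<ge> 1" using b by (simp add: admissible_def)
    then show "sqnorm (vector [-1/2, 1/2, 0]) \<le> sqnorm b \<and>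
        (sqnorm b = sqnorm (vector [-1/2, 1/2, 0]) \<longrightarrow> increasing_rearrangement b = [-1/2, 0, 1/2])"
      using edge_bound by (simp add: sqnorm_def power2_eq_square)
  qed
qed

lemma matrix_mult_nonzeroE:
  assumes "(A::'k::field mat3) ** B \<noteq> 0"
  obtains i j k where "A$i$j \<noteq> 0" "B$j$k \<noteq> 0"
proof -
  obtain i k where "(A ** B) $ i $ k \<noteq> 0" using assms by (auto simp: vec_eq_iff)
  have "\<exists>j. A$i$j \<noteq> 0 \<and> B$j$k \<noteq> 0"
  proof (rule ccontr)
    assume "\<not> ?thesis"
    then have summand: "A$i$j * B$j$k = 0" for j by auto
    have "(A ** B) $ i $ k = 0" by (simp only: mult_entry summand) simp
    then show False using \<open>(A ** B) $ i $ k \<noteq> 0\<close> by simp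
  qed
  then show ?thesis using that by blast
qed

text \<open>
  Nonvanishing of a product \<open>Y ** Z\<close> of members of the pair is invariant under
  conjugation, and a nonzero entry of the product comes from entries at positions
  \<open>(p,q)\<close> and \<open>(q,r)\<close>.
\<close>

lemma GL_orbits_stratum_regular:
  "GL_orbits regular_forms \<subseteq> (hesselink_stratum [-1, 0, 1] :: ('k::field mat3 \<times> 'k mat3) set)"
proof
  fix A :: "'k mat3 \<times> 'k mat3" assume "A \<in> GL_orbits regular_forms"
  then obtain g X where g: "invertible g" and A: "A = conj_act g X" and "X \<in> regular_forms"
    unfolding GL_orbits_def by blast
  then obtain a1 b1 c1 a2 b2 c2 where X: "X = (lower a1 b1 c1, lower a2 b2 c2)"
    and ab: "a1 \<noteq> 0 \<or> a2 \<noteq> 0" "b1 \<noteq> 0 \<or> b2 \<noteq> 0"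
    by (auto simp: regular_forms_def normal_forms_lower)
  have nz: "lower a b c ** lower a' b' c' \<noteq> 0" if "b \<noteq> 0" "a' \<noteq> 0" for a b c a' b' c' :: 'k
    using that unfolding lower_mult by (simp add: mat_eq_iff)
  have "\<exists>Y\<in>{fst X, snd X}. \<exists>Z\<in>{fst X, snd X}. Y ** Z \<noteq> 0"
    using ab unfolding X by (elim disjE) (simp_all add: nz)
  then obtain Y Z where YZ: "Y \<in> {fst X, snd X}" "Z \<in> {fst X, snd X}" "Y ** Z \<noteq> 0" by blast
  show "A \<in> hesselink_stratum [-1, 0, 1]"
    unfolding A
  proof (rule hesselink_stratumI[OF X g])
    show "admissible (vector [-1, 0, 1]) X" by (simp add: admissible_def X forall_3)
    fix h :: "'k mat3" and b assume h: "invertible h" and b: "admissible b (conj_act h X)"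
    define k where "k = matrix_inv h"
    have hk: "h ** k = mat 1" "k ** h = mat 1" using h by (simp_all add: k_def matrix_inv_inverse)
    have "(h ** Y ** k) ** (h ** Z ** k) \<noteq> 0"
    proof
      assume 0: "(h ** Y ** k) ** (h ** Z ** k) = 0"
      have "Y ** Z = k ** ((h ** Y ** k) ** (h ** Z ** k)) ** h"
        using hk by (metis matrix_mul_assoc matrix_mul_lid matrix_mul_rid)
      then show False using YZ(3) 0 by simp
    qed
    then obtain p q r where "(h ** Y ** k)$p$q \<noteq> 0" "(h ** Z ** k)$q$r \<noteq> 0"
      by (rule matrix_mult_nonzeroE)
    moreover have "(h ** Y ** k) \<in> {fst (conj_act h X), snd (conj_act h X)}"
      "(h ** Z ** k) \<in> {fst (conj_act h X), snd (conj_act h X)}"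
      using YZ by (auto simp: conj_act_def k_def)
    ultimately have "b$p - b$q \<ge> 1" "b$q - b$r \<ge> 1" using b by (auto simp: admissible_def)
    then show "sqnorm (vector [-1, 0, 1]) \<le> sqnorm b \<and>
        (sqnorm b = sqnorm (vector [-1, 0, 1]) \<longrightarrow> increasing_rearrangement b = [-1, 0, 1])"
      using chain_bound by (simp add: sqnorm_def)
  qed
qed

text \<open>
  Two columns supported on a single common row would be proportional.
\<close>

lemma invertible_two_columns:
  fixes g :: "'k::field mat3"
  assumes "invertible g"
  shows "\<exists>i k. i \<noteq> k \<and> (g$i$2 \<noteq> 0 \<or> g$i$3 \<noteq> 0) \<and> (g$k$2 \<noteq> 0 \<or> g$k$3 \<noteq> 0)"
proof (rule ccontr)
  assume "\<not> ?thesis"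
  then have "i = k \<or> g$i$2 = 0 \<and> g$i$3 = 0 \<or> g$k$2 = 0 \<and> g$k$3 = 0" for i k by blast
  from this[of 1 2] this[of 1 3] this[of 2 3] have "det g = 0" by (auto simp: det_3)
  then show False using assms by (simp add: invertible_det_nz)
qed

lemma invertible_two_rows:
  fixes g :: "'k::field mat3"
  assumes "invertible g"
  shows "\<exists>i k. i \<noteq> k \<and> (g$1$i \<noteq> 0 \<or> g$2$i \<noteq> 0) \<and> (g$1$k \<noteq> 0 \<or> g$2$k \<noteq> 0)"
proof (rule ccontr)
  assume "\<not> ?thesis"
  then have "i = k \<or> g$1$i = 0 \<and> g$2$i = 0 \<or> g$1$k = 0 \<and> g$2$k = 0" for i k by blast
  from this[of 1 2] this[of 1 3] this[of 2 3] have "det g = 0" by (auto simp: det_3)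
  then show False using assms by (simp add: invertible_det_nz)
qed

text \<open>
  With \<open>k = matrix_inv h\<close>, the conjugates of \<open>E\<^sub>2\<^sub>1\<close> and
  \<open>E\<^sub>3\<^sub>1\<close> are the products of the second and third columns of \<open>h\<close>
  with the first row of \<open>k\<close>. The columns together meet two rows, so two entries
  occur in one column.
\<close>

lemma GL_orbits_stratum_C: "GL_orbits {pair_C} \<subseteq> (hesselink_stratum [-2/3, 1/3, 1/3] :: ('k::field mat3 \<times> 'k mat3) set)"
proof
  fix A :: "'k mat3 \<times> 'k mat3" assume "A \<in> GL_orbits {pair_C}"
  then obtain g where g: "invertible g" and A: "A = conj_act g pair_C"
    unfolding GL_orbits_def by blast
  show "A \<in> hesselink_stratum [-2/3, 1/3, 1/3]"
    unfolding A
  proof (rule hesselink_stratumI[OF normal_forms_lower(6) g])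
    show "admissible (vector [-2/3, 1/3, 1/3]) (pair_C :: 'k mat3 \<times> 'k mat3)"
      by (simp add: admissible_def normal_forms_lower forall_3)
    fix h :: "'k mat3" and b assume h: "invertible h" and b: "admissible b (conj_act h pair_C)"
    define k where "k = matrix_inv h"
    have "(k ** h) $ 1 $ 1 = 1" using h by (simp add: k_def matrix_inv_inverse mat_def)
    then have "k$1$1 \<noteq> 0 \<or> k$1$2 \<noteq> 0 \<or> k$1$3 \<noteq> 0" by (auto simp: mult_entry)
    then obtain j where j: "k $ 1 $ j \<noteq> 0" by blast
    obtain p q where pq: "p \<noteq> q" "h$p$2 \<noteq> 0 \<or> h$p$3 \<noteq> 0" "h$q$2 \<noteq> 0 \<or> h$q$3 \<noteq> 0"
      using invertible_two_columns[OF h] by blast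
    have "fst (conj_act h pair_C) $ p $ j = h$p$2 * k$1$j" "snd (conj_act h pair_C) $ p $ j = h$p$3 * k$1$j" for p
      by (simp_all add: conj_act_def normal_forms_lower mult_entry k_def)
    then have "b$p - b$j \<ge> 1" "b$q - b$j \<ge> 1" using b pq j by (auto simp: admissible_def)
    then show "sqnorm (vector [-2/3, 1/3, 1/3]) \<le> sqnorm b \<and>
        (sqnorm b = sqnorm (vector [-2/3, 1/3, 1/3]) \<longrightarrow> increasing_rearrangement b = [-2/3, 1/3, 1/3])"
      using fork_bound pq(1) by (simp add: sqnorm_def power2_eq_square)
  qed
qed

text \<open>
  Dually, the conjugates of \<open>E\<^sub>3\<^sub>1\<close> and \<open>E\<^sub>3\<^sub>2\<close>
  are the products of the third column of \<open>h\<close> with the first two rows of its inverse.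
\<close>

lemma GL_orbits_stratum_D: "GL_orbits {pair_D} \<subseteq> (hesselink_stratum [-1/3, -1/3, 2/3] :: ('k::field mat3 \<times> 'k mat3) set)"
proof
  fix A :: "'k mat3 \<times> 'k mat3" assume "A \<in> GL_orbits {pair_D}"
  then obtain g where g: "invertible g" and A: "A = conj_act g pair_D"
    unfolding GL_orbits_def by blast
  show "A \<in> hesselink_stratum [-1/3, -1/3, 2/3]"
    unfolding A
  proof (rule hesselink_stratumI[OF normal_forms_lower(7) g])
    show "admissible (vector [-1/3, -1/3, 2/3]) (pair_D :: 'k mat3 \<times> 'k mat3)"
      by (simp add: admissible_def normal_forms_lower forall_3)
    fix h :: "'k mat3" and b assume h: "invertible h" and b: "admissible b (conj_act h pair_D)"
    define k where "k = matrix_inv h"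
    have "(k ** h) $ 3 $ 3 = 1" using h by (simp add: k_def matrix_inv_inverse mat_def)
    then have "h$1$3 \<noteq> 0 \<or> h$2$3 \<noteq> 0 \<or> h$3$3 \<noteq> 0" by (auto simp: mult_entry)
    then obtain i where i: "h $ i $ 3 \<noteq> 0" by blast
    obtain p q where pq: "p \<noteq> q" "k$1$p \<noteq> 0 \<or> k$2$p \<noteq> 0" "k$1$q \<noteq> 0 \<or> k$2$q \<noteq> 0"
      using invertible_two_rows[OF invertible_matrix_inv[OF h]] k_def by blast
    have "fst (conj_act h pair_D) $ i $ p = h$i$3 * k$1$p" "snd (conj_act h pair_D) $ i $ p = h$i$3 * k$2$p" for p
      by (simp_all add: conj_act_def normal_forms_lower mult_entry k_def)
    then have "b$i - b$p \<ge> 1" "b$i - b$q \<ge> 1" using b pq i by (auto simp: admissible_def)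
    then show "sqnorm (vector [-1/3, -1/3, 2/3]) \<le> sqnorm b \<and>
        (sqnorm b = sqnorm (vector [-1/3, -1/3, 2/3]) \<longrightarrow> increasing_rearrangement b = [-1/3, -1/3, 2/3])"
      using cofork_bound pq(1) by (simp add: sqnorm_def power2_eq_square)
  qed
qed

lemma GL_orbits_O: "GL_orbits {pair_O} = {pair_O :: 'k::field mat3 \<times> 'k mat3}"
proof -
  have "conj_act g pair_O = pair_O" for g :: "'k mat3" by (simp add: conj_act_def pair_O_def)
  moreover have "invertible (mat 1 :: 'k mat3)" by (metis invertible_def matrix_mul_lid)
  ultimately show ?thesis unfolding GL_orbits_def by (auto simp del: split_paired_Ex)
qed

lemma GL_orbits_stratum_O: "GL_orbits {pair_O} \<subseteq> (hesselink_stratum [0, 0, 0] :: ('k::field mat3 \<times> 'k mat3) set)"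
proof
  fix A :: "'k mat3 \<times> 'k mat3" assume "A \<in> GL_orbits {pair_O}"
  then obtain g where g: "invertible g" and A: "A = conj_act g pair_O"
    unfolding GL_orbits_def by blast
  show "A \<in> hesselink_stratum [0, 0, 0]"
    unfolding A
  proof (rule hesselink_stratumI[OF normal_forms_lower(10) g])
    show "admissible 0 (pair_O :: 'k mat3 \<times> 'k mat3)"
      by (simp add: admissible_def pair_O_def)
    fix b
    show "sqnorm 0 \<le> sqnorm b \<and> (sqnorm b = sqnorm 0 \<longrightarrow> increasing_rearrangement b = [0, 0, 0])"
      by (auto simp: sqnorm_def increasing_rearrangement_def add_nonneg_eq_0_iff)
  qed
qed

lemma hesselink_stratum_disjoint:
  assumes "A \<in> hesselink_stratum \<beta>" "A \<in> hesselink_stratum \<gamma>"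
  shows "\<beta> = \<gamma>"
  using assms unfolding hesselink_stratum_def by blast

theorem proposition6p1:
  "(hesselink_stratum [0, 0, 0] :: ('k::alg_closed_field mat3 \<times> 'k mat3) set) = {pair_O} \<and>
   (hesselink_stratum [-1/2, 0, 1/2] :: ('k mat3 \<times> 'k mat3) set) =
     GL_orbits ({pair_E l | l. True} \<union> {pair_E_inf}) \<and>
   (hesselink_stratum [-1/3, -1/3, 2/3] :: ('k mat3 \<times> 'k mat3) set) = GL_orbits {pair_D} \<and>
   (hesselink_stratum [-2/3, 1/3, 1/3] :: ('k mat3 \<times> 'k mat3) set) = GL_orbits {pair_C} \<and>
   (hesselink_stratum [-1, 0, 1] :: ('k mat3 \<times> 'k mat3) set) =
     GL_orbits ({pair_A l m | l m. m \<noteq> 0} \<union> {pair_A_fin_inf l | l. True} \<union>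
                {pair_A_inf_fin l | l. True} \<union> {pair_B l m | l m. True} \<union>
                {pair_B_inf_fin l | l. True})"
proof -
  \<comment> \<open>Indexing the five orbit sets by their sequences makes the disjointness argument uniform; on
      \<open>betas\<close> the last branch is taken for \<open>[-1, 0, 1]\<close> only.\<close>
  define orb :: "rat list \<Rightarrow> ('k mat3 \<times> 'k mat3) set" where
    "orb \<beta> = (if \<beta> = [0, 0, 0] then GL_orbits {pair_O}
       else if \<beta> = [-1/2, 0, 1/2] then GL_orbits rank_one_forms
       else if \<beta> = [-1/3, -1/3, 2/3] then GL_orbits {pair_D}
       else if \<beta> = [-2/3, 1/3, 1/3] then GL_orbits {pair_C}
       else GL_orbits regular_forms)" for \<beta>
  define betas :: "rat list set" where
    "betas = {[0, 0, 0], [-1/2, 0, 1/2], [-1/3, -1/3, 2/3], [-2/3, 1/3, 1/3], [-1, 0, 1]}"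
  have sub: "orb \<beta> \<subseteq> hesselink_stratum \<beta>" if "\<beta> \<in> betas" for \<beta>
    using that GL_orbits_stratum_O GL_orbits_stratum_rank_one GL_orbits_stratum_D GL_orbits_stratum_C
      GL_orbits_stratum_regular
    unfolding orb_def betas_def by fastforce
  have cover: "\<exists>\<gamma>\<in>betas. A \<in> orb \<gamma>" if "A \<in> nilpotent_pairs" for A
    using nilpotent_pair_cases[OF that] unfolding orb_def betas_def by auto
  have eq: "hesselink_stratum \<beta> = orb \<beta>" if "\<beta> \<in> betas" for \<beta>
  proof
    show "hesselink_stratum \<beta> \<subseteq> orb \<beta>"
    proof
      fix A :: "'k mat3 \<times> 'k mat3" assume A: "A \<in> hesselink_stratum \<beta>"
      then have "A \<in> nilpotent_pairs" by (simp add: hesselink_stratum_def)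
      then obtain \<gamma> where \<gamma>: "\<gamma> \<in> betas" "A \<in> orb \<gamma>" using cover by blast
      then have "\<beta> = \<gamma>" using sub A hesselink_stratum_disjoint by blast
      then show "A \<in> orb \<beta>" using \<gamma> by simp
    qed
  qed (rule sub[OF that])
  show ?thesis
    using eq[of "[0, 0, 0]"] eq[of "[-1/2, 0, 1/2]"] eq[of "[-1/3, -1/3, 2/3]"]
      eq[of "[-2/3, 1/3, 1/3]"] eq[of "[-1, 0, 1]"]
    by (simp add: betas_def orb_def GL_orbits_O regular_forms_def)
qed

end
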